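(* For every $k\in\{3,4,5,6\}$ there exists a line arrangement $\mathcal{A}$ in the complex projective plane $\mathbb{P}^2(\mathbb{C})$ such that $$\Lambda_{\{2\},\{k\}}(\mathcal{A})\neq \mathcal{A}\quad\text{and}\quad \Lambda_{\{2\},\{k\}}\bigl(\Lambda_{\{2\},\{k\}}(\mathcal{A})\bigr)=\mathcal{A}.$$
   Context: A line arrangement is a finite set of (distinct) lines in the projective plane. For a line arrangement $L_0$ and an integer $j\geq 2$, a $j$-point of $L_0$ is a point of the plane lying on exactly $j$ lines of $L_0$; $\mathcal{P}_{\{j\}}(L_0)$ denotes the finite set of all $j$-points of $L_0$. For a finite set of points $P_0$ and an integer $j\ge 2$, $\mathcal{L}_{\{j\}}(P_0)$ denotes the set of lines of the plane containing exactly $j$ points of $P_0$. For integers $m,k\geq 2$, the line operator $\Lambda_{\{m\},\{k\}}$ is defined by $\Lambda_{\{m\},\{k\}}(L_0)=\mathcal{L}_{\{k\}}(\mathcal{P}_{\{m\}}(L_0))$. In particular, $\Lambda_{\{2\},\{k\}}(L_0)$ is the set of lines of the plane that contain exactly $k$ double points of $L_0$. *)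

theory Defs
  imports "HOL-Analysis.Cartesian_Space"
begin

text \<open>
  The complex projective plane is the projectivization of the complex vector space
  \<^typ>\<open>complex^3\<close>: its points are the one-dimensional linear subspaces, its lines the
  two-dimensional ones, and a point lies on a line iff it is contained in it as a subspace.
  The constants prefixed by \<open>vec\<close> refer to the scalar multiplication \<open>*s\<close>, so that subspaces
  and dimensions are taken over the complex numbers.
\<close>

definition cp2_points :: "(complex^3) set set" where
  "cp2_points = {p. vec.subspace p \<and> vec.dim p = 1}"

definition cp2_lines :: "(complex^3) set set" where
  "cp2_lines = {l. vec.subspace l \<and> vec.dim l = 2}"

definition line_arrangement :: "(complex^3) set set \<Rightarrow> bool" where
  "line_arrangement L \<longleftrightarrow> finite L \<and> L \<subseteq> cp2_lines"

text \<open>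
  Only multiplicities at least 2 are used below; in particular \<open>card\<close> being 0 on infinite
  sets does not interfere.
\<close>

definition multiple_points :: "nat \<Rightarrow> (complex^3) set set \<Rightarrow> (complex^3) set set" where
  "multiple_points j L = {p \<in> cp2_points. card {l \<in> L. p \<subseteq> l} = j}"

definition rich_lines :: "nat \<Rightarrow> (complex^3) set set \<Rightarrow> (complex^3) set set" where
  "rich_lines j P = {l \<in> cp2_lines. card {p \<in> P. p \<subseteq> l} = j}"

definition line_operator :: "nat \<Rightarrow> nat \<Rightarrow> (complex^3) set set \<Rightarrow> (complex^3) set set" where
  "line_operator m k L = rich_lines k (multiple_points m L)"

end

theory Submission
  imports Defs
begin

text \<open>
  For each \<open>k\<close> there is an arrangement whose image under the operator is the mirror image
  under the projectivity \<open>swap\<close>, the exchange of the first two coordinates, and differs from the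
  arrangement itself. The operator commutes with projectivities and \<open>swap\<close> is an involution, so a
  second application returns to the start (\<open>line_operator_flips\<close>).

  For \<open>k = 3, 4, 6\<close> let \<open>m = 1, 2, 3\<close>, and take the lines \<open>y = a z\<close>, \<open>z = a x\<close>, \<open>x = a y\<close> for all \<open>a\<close> with
  \<open>a^m \<in> {1, \<tau>}\<close>, where \<open>\<tau> = 2^m\<close>. For a point off the coordinate triangle put \<open>u = (y/z)^m\<close>,
  \<open>v = (z/x)^m\<close>, \<open>w = (x/y)^m\<close>, so that \<open>u v w = 1\<close>. Double points off the triangle are the points for
  which exactly two of \<open>u, v, w\<close> belong to \<open>{1, \<tau>}\<close>. These are nine classes with \<open>m^2\<close> points each: three cyclic
  shifts of \<open>(1, \<tau>, 1/\<tau>)\<close>, of \<open>(\<tau>, 1, 1/\<tau>)\<close> and of \<open>(\<tau>, \<tau>, 1/\<tau>^2)\<close>. A line \<open>y = a z\<close> meets each class with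
  \<open>u = a^m\<close> in \<open>m\<close> points, and there are two such classes for \<open>u = 1\<close> and for \<open>u = 1/\<tau>\<close>, four for \<open>u = \<tau>\<close>
  and one for \<open>u = 1/\<tau>^2\<close>. Hence the lines through the vertices with exactly \<open>2 m\<close> double points off the triangle are those
  with \<open>a^m \<in> {1, 1/\<tau>}\<close>, which form the mirror image. When \<open>m = 1\<close>, the vertices are double points
  too, and each line through a vertex gains one.

  For \<open>k = 5\<close> the normals of the lines are points of an elliptic curve in the dual plane:
  all points of order dividing 4 except \<open>0, u, v, w\<close>, where \<open>u\<close> and \<open>v\<close> generate the 4-torsion and \<open>u + v + w = 0\<close>. A
  double point is dual to a line that contains exactly two points of this set \<open>S\<close>, and three points
  are collinear iff their sum is zero. Counting in the group shows that exactly five such lines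
  pass through each of \<open>u, v, w\<close> and through each point of \<open>S\<close> other than \<open>-u, -v, -w\<close>, and only three
  through \<open>-u, -v, -w\<close> and through \<open>0\<close>. So the result is \<open>-S\<close>, and the coordinates
  are chosen such that \<open>swap\<close> acts on the curve as negation.

  These counts leave open whether some other line happens to contain exactly \<open>k\<close> double
  points. This is excluded by a finite exact calculation over the Gaussian or the Eisenstein
  integers: \<open>certificate\<close> states what is to be calculated, and \<open>certificate_sound\<close> shows that it is
  enough.
\<close>

section \<open>Points and lines as vectors\<close>

definition dot3 :: "complex^3 \<Rightarrow> complex^3 \<Rightarrow> complex" where
  "dot3 u v = u$1 * v$1 + u$2 * v$2 + u$3 * v$3"

definition cross :: "complex^3 \<Rightarrow> complex^3 \<Rightarrow> complex^3" where
  "cross u v = vector [u$2 * v$3 - u$3 * v$2, u$3 * v$1 - u$1 * v$3, u$1 * v$2 - u$2 * v$1]"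

definition line_of :: "complex^3 \<Rightarrow> (complex^3) set" where
  "line_of n = {v. dot3 n v = 0}"

definition point_of :: "complex^3 \<Rightarrow> (complex^3) set" where
  "point_of v = vec.span {v}"

lemmas coords = dot3_def cross_def vec_eq_iff forall_3

lemma dot3_cross_self [simp]: "dot3 (cross u v) u = 0" "dot3 (cross u v) v = 0"
  by (simp_all add: coords algebra_simps)

lemma dot3_commute: "dot3 u v = dot3 v u"
  by (simp add: coords algebra_simps)

lemma dot3_zero [simp]: "dot3 0 v = 0" "dot3 v 0 = 0"
  by (simp_all add: coords)

lemma dot3_add: "dot3 n (u + v) = dot3 n u + dot3 n v"
  by (simp add: coords algebra_simps)

lemma dot3_smult: "dot3 n (c *s u) = c * dot3 n u"
  by (simp add: coords algebra_simps)

lemma cross_zero [simp]: "cross 0 v = 0" "cross v 0 = 0" "cross v v = 0"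
  by (simp_all add: coords)

lemma cross_smult: "cross u (c *s u) = 0"
  by (simp add: coords)

lemma cross_swap_eq_0: "cross u v = 0 \<longleftrightarrow> cross v u = 0"
  by (auto simp: coords algebra_simps)

lemma lagrange: "dot3 (cross m n) (cross u v) = dot3 m u * dot3 n v - dot3 m v * dot3 n u"
  by (simp add: coords algebra_simps)

lemma cross_cross: "cross n (cross u v) = dot3 n v *s u - dot3 n u *s v"
  by (simp add: coords algebra_simps)

text \<open>
  The bilinear form has nonzero isotropic vectors over the complex numbers, so a vector cannot be
  split off along a normal by means of that normal itself. Cramer's rule with an auxiliary \<open>m\<close>
  outside the plane takes the place of orthogonal projection.
\<close>
lemma cramer:
  "dot3 m (cross u v) *s w = dot3 w (cross u v) *s m + dot3 m (cross w v) *s u + dot3 m (cross u w) *s v"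
  by (simp add: coords algebra_simps)

lemma ex_dot3_nonzero:
  assumes "n \<noteq> 0" shows "\<exists>m. dot3 m n \<noteq> 0"
proof -
  have "dot3 (vector [1,0,0]) n = n$1" "dot3 (vector [0,1,0]) n = n$2" "dot3 (vector [0,0,1]) n = n$3"
    by (simp_all add: dot3_def)
  moreover have "n$1 \<noteq> 0 \<or> n$2 \<noteq> 0 \<or> n$3 \<noteq> 0"
    using assms by (simp add: vec_eq_iff forall_3)
  ultimately show ?thesis by metis
qed

lemma ex_cross_dot3_nonzero:
  assumes "n \<noteq> 0" shows "\<exists>a b. dot3 n (cross a b) \<noteq> 0"
proof -
  have "dot3 n (cross (vector [0,1,0]) (vector [0,0,1])) = n$1"
       "dot3 n (cross (vector [0,0,1]) (vector [1,0,0])) = n$2"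
       "dot3 n (cross (vector [1,0,0]) (vector [0,1,0])) = n$3"
    by (simp_all add: coords)
  moreover have "n$1 \<noteq> 0 \<or> n$2 \<noteq> 0 \<or> n$3 \<noteq> 0"
    using assms by (simp add: vec_eq_iff forall_3)
  ultimately show ?thesis by metis
qed

lemma dot3_eq_0_transfer:
  assumes "cross n n' = 0" "n \<noteq> 0" "dot3 n w = 0" shows "dot3 n' w = 0"
proof -
  obtain m where m: "dot3 m n \<noteq> 0" using ex_dot3_nonzero assms(2) by blast
  have "dot3 (cross n n') (cross m w) = dot3 n m * dot3 n' w - dot3 n w * dot3 n' m"
    by (rule lagrange)
  with assms m show ?thesis by (auto simp: dot3_commute)
qed

lemma cross_eq_0_smult:
  assumes "cross v v' = 0" "v \<noteq> 0" shows "\<exists>c. v' = c *s v"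
proof -
  obtain m where m: "dot3 m v \<noteq> 0" using ex_dot3_nonzero assms(2) by blast
  have "cross m (cross v v') = 0" using assms by simp
  then have "dot3 m v *s v' = dot3 m v' *s v" by (simp add: cross_cross)
  then have "v' = (dot3 m v' / dot3 m v) *s v"
    using m by (simp add: vec_eq_iff field_simps)
  then show ?thesis by blast
qed

lemma cross_trans:
  assumes "cross u v = 0" "cross v w = 0" "v \<noteq> 0" shows "cross u w = 0"
  using cross_eq_0_smult[of v u] cross_eq_0_smult[of v w] assms
  by (auto simp: cross_swap_eq_0[of u] coords)

lemma subspace_line_of: "vec.subspace (line_of n)"
  by (auto simp: vec.subspace_def line_of_def dot3_add dot3_smult)

lemma independent_pair:
  assumes "cross u v \<noteq> 0" shows "vec.independent {u, v}" "u \<noteq> v"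
proof -
  show "u \<noteq> v" using assms by auto
  have "v \<noteq> 0" using assms by auto
  moreover have "u \<notin> vec.span {v}"
    using assms by (auto simp: vec.span_singleton cross_smult cross_swap_eq_0[of _ v])
  ultimately show "vec.independent {u, v}"
    using \<open>u \<noteq> v\<close> by (simp add: vec.independent_insert)
qed

lemma span_pair:
  assumes "cross u v \<noteq> 0" shows "vec.span {u, v} = line_of (cross u v)"
proof
  show "vec.span {u, v} \<subseteq> line_of (cross u v)"
    by (rule vec.span_minimal) (simp_all add: subspace_line_of, simp add: line_of_def)
  show "line_of (cross u v) \<subseteq> vec.span {u, v}"
  proof
    fix w assume "w \<in> line_of (cross u v)"
    then have w: "dot3 w (cross u v) = 0" by (simp add: line_of_def dot3_commute)
    obtain m where m: "dot3 m (cross u v) \<noteq> 0" using ex_dot3_nonzero assms by blast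
    let ?d = "dot3 m (cross u v)"
    have "?d *s w = dot3 m (cross w v) *s u + dot3 m (cross u w) *s v"
      using cramer[of m u v w] w by simp
    then have "w = (dot3 m (cross w v) / ?d) *s u + (dot3 m (cross u w) / ?d) *s v"
      using m by (simp add: vec_eq_iff field_simps)
    then show "w \<in> vec.span {u, v}"
      by (metis insertI1 insertI2 singletonI vec.span_add vec.span_base vec.span_scale)
  qed
qed

lemma line_of_eqI:
  assumes "cross n n' = 0" "n \<noteq> 0" "n' \<noteq> 0" shows "line_of n = line_of n'"
  using dot3_eq_0_transfer[of n n'] dot3_eq_0_transfer[of n' n] assms
  by (auto simp: line_of_def cross_swap_eq_0[of n'])

lemma line_of_eq_iff:
  assumes "n \<noteq> 0" "n' \<noteq> 0" shows "line_of n = line_of n' \<longleftrightarrow> cross n n' = 0"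
proof
  assume eq: "line_of n = line_of n'"
  show "cross n n' = 0"
  proof (rule ccontr)
    assume "cross n n' \<noteq> 0"
    then obtain a where a: "dot3 a (cross n n') \<noteq> 0" using ex_dot3_nonzero by blast
    have "cross a n \<in> line_of n" by (simp add: line_of_def dot3_commute[of n])
    then have "cross a n \<in> line_of n'" using eq by simp
    then have "dot3 n' (cross a n) = 0" by (simp add: line_of_def)
    moreover have "dot3 n' (cross a n) = dot3 a (cross n n')" by (simp add: coords algebra_simps)
    ultimately show False using a by simp
  qed
qed (use assms line_of_eqI in blast)

text \<open>
  Every nonzero normal defines a projective line because \<open>n\<close> is a multiple of
  \<open>cross (cross a n) (cross b n)\<close>, so that the two factors span the plane.
\<close>
lemma cp2_lines_eq: "cp2_lines = line_of ` {n. n \<noteq> 0}"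
proof
  show "cp2_lines \<subseteq> line_of ` {n. n \<noteq> 0}"
  proof
    fix l assume "l \<in> cp2_lines"
    then have l: "vec.subspace l" "vec.dim l = 2" by (auto simp: cp2_lines_def)
    obtain B where B: "B \<subseteq> l" "vec.independent B" "l \<subseteq> vec.span B" "card B = vec.dim l"
      using vec.basis_exists by blast
    obtain u v where uv: "B = {u, v}" "u \<noteq> v"
      using B(4) l(2) by (auto simp: card_2_iff)
    have "cross u v \<noteq> 0"
    proof
      assume "cross u v = 0"
      moreover have "v \<noteq> 0" "u \<notin> vec.span {v}"
        using B(2) uv by (auto simp: vec.independent_insert split: if_splits)
      ultimately obtain c where "u = c *s v"
        using cross_eq_0_smult[of v u] by (auto simp: cross_swap_eq_0[of u])
      with \<open>u \<notin> vec.span {v}\<close> show False by (auto simp: vec.span_singleton)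
    qed
    moreover have "l = vec.span {u, v}"
      using B l(1) uv vec.span_minimal by blast
    ultimately show "l \<in> line_of ` {n. n \<noteq> 0}" using span_pair by blast
  qed
  show "line_of ` {n. n \<noteq> 0} \<subseteq> cp2_lines"
  proof clarify
    fix n :: "complex^3" assume n: "n \<noteq> 0"
    obtain a b where ab: "dot3 n (cross a b) \<noteq> 0" using ex_cross_dot3_nonzero n by blast
    let ?u = "cross a n" and ?v = "cross b n"
    have uv: "cross ?u ?v = dot3 n (cross a b) *s n" by (simp add: coords algebra_simps)
    then have ne: "cross ?u ?v \<noteq> 0" using ab n by (auto simp: vec_eq_iff)
    have "line_of n = line_of (cross ?u ?v)"
      by (rule line_of_eqI) (use n ne uv in \<open>auto simp: cross_smult\<close>)
    also have "\<dots> = vec.span {?u, ?v}" using span_pair ne by simp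
    finally have eq: "line_of n = vec.span {?u, ?v}" .
    have "vec.dim (vec.span {?u, ?v}) = card {?u, ?v}"
      using independent_pair[OF ne] by (simp add: vec.dim_span vec.dim_eq_card_independent)
    then have "vec.dim (line_of n) = 2" using eq independent_pair(2)[OF ne] by simp
    then show "line_of n \<in> cp2_lines" by (simp add: cp2_lines_def subspace_line_of)
  qed
qed

lemma cp2_points_eq: "cp2_points = point_of ` {v. v \<noteq> 0}"
proof
  show "cp2_points \<subseteq> point_of ` {v. v \<noteq> 0}"
  proof
    fix p assume "p \<in> cp2_points"
    then have p: "vec.subspace p" "vec.dim p = 1" by (auto simp: cp2_points_def)
    obtain B where B: "B \<subseteq> p" "vec.independent B" "p \<subseteq> vec.span B" "card B = vec.dim p"
      using vec.basis_exists by blast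
    obtain v where v: "B = {v}" using B(4) p(2) by (auto simp: card_1_singleton_iff)
    have "v \<noteq> 0" using B(2) v vec.dependent_zero by blast
    moreover have "p = point_of v"
      using B p(1) v vec.span_minimal unfolding point_of_def by blast
    ultimately show "p \<in> point_of ` {v. v \<noteq> 0}" by blast
  qed
  show "point_of ` {v. v \<noteq> 0} \<subseteq> cp2_points"
    by (auto simp: cp2_points_def point_of_def vec.dim_span vec.dim_eq_card_independent)
qed

lemma point_of_subset_line_of: "point_of v \<subseteq> line_of n \<longleftrightarrow> dot3 n v = 0"
proof
  show "point_of v \<subseteq> line_of n \<Longrightarrow> dot3 n v = 0"
    using vec.span_base[of v "{v}"] by (auto simp: point_of_def line_of_def)
  assume "dot3 n v = 0"
  then show "point_of v \<subseteq> line_of n"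
    unfolding point_of_def by (intro vec.span_minimal subspace_line_of) (simp add: line_of_def)
qed

lemma point_of_eq_iff:
  assumes "v \<noteq> 0" "v' \<noteq> 0" shows "point_of v = point_of v' \<longleftrightarrow> cross v v' = 0"
proof
  assume "point_of v = point_of v'"
  then have "v' \<in> vec.span {v}" using vec.span_base[of v' "{v'}"] by (simp add: point_of_def)
  then show "cross v v' = 0" by (auto simp: vec.span_singleton cross_smult)
next
  assume c: "cross v v' = 0"
  have "point_of v' \<subseteq> point_of v" if "cross v v' = 0" "v \<noteq> 0" for v v'
    using cross_eq_0_smult[OF that] unfolding point_of_def
    by (intro vec.span_minimal vec.subspace_span) (auto simp: vec.span_singleton)
  from this[OF c] this[of v' v] show "point_of v = point_of v'"
    using c assms by (auto simp: cross_swap_eq_0[of v'])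
qed

section \<open>The symmetry exchanging the first two coordinates\<close>

definition swap :: "complex^3 \<Rightarrow> complex^3" where
  "swap v = vector [v$2, v$1, v$3]"

lemma swap_swap [simp]: "swap (swap v) = v"
  by (simp add: swap_def coords)

lemma swap_eq_0_iff [simp]: "swap v = 0 \<longleftrightarrow> v = 0"
  by (auto simp: swap_def coords)

lemma image_swap_swap [simp]: "swap ` (swap ` S) = S"
  by (simp add: image_image)

lemma dot3_swap: "dot3 (swap u) v = dot3 u (swap v)"
  by (simp add: dot3_def swap_def algebra_simps)

lemma swap_line_of: "swap ` line_of n = line_of (swap n)"
  by (auto simp: line_of_def dot3_swap image_iff) (metis swap_swap)

lemma swap_point_of: "swap ` point_of v = point_of (swap v)"
proof -
  have "swap (c *s v) = c *s swap v" for c by (simp add: swap_def coords)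
  then show ?thesis by (auto simp: point_of_def vec.span_singleton image_iff)
qed

lemma swap_in_cp2_points [simp]: "swap ` p \<in> cp2_points \<longleftrightarrow> p \<in> cp2_points"
proof -
  have "swap ` p \<in> cp2_points" if "p \<in> cp2_points" for p
    using that by (auto simp: cp2_points_eq swap_point_of)
  from this this[of "swap ` p"] show ?thesis by auto
qed

lemma swap_in_cp2_lines [simp]: "swap ` l \<in> cp2_lines \<longleftrightarrow> l \<in> cp2_lines"
proof -
  have "swap ` l \<in> cp2_lines" if "l \<in> cp2_lines" for l
    using that by (auto simp: cp2_lines_eq swap_line_of)
  from this this[of "swap ` l"] show ?thesis by auto
qed

lemma swap_subset_iff: "swap ` S \<subseteq> T \<longleftrightarrow> S \<subseteq> swap ` T"
  by (metis image_mono image_swap_swap)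

lemma mem_image_image_swap: "S \<in> (`) swap ` X \<longleftrightarrow> swap ` S \<in> X"
proof
  show "swap ` S \<in> X" if "S \<in> (`) swap ` X" using that by auto
  show "S \<in> (`) swap ` X" if "swap ` S \<in> X" by (rule rev_image_eqI[OF that]) simp
qed

lemma inj_image_swap: "inj_on ((`) swap) X"
  by (metis image_swap_swap inj_onI)

lemma multiple_points_swap: "multiple_points j ((`) swap ` L) = (`) swap ` multiple_points j L"
proof -
  have "{l \<in> (`) swap ` L. p \<subseteq> l} = (`) swap ` {l \<in> L. swap ` p \<subseteq> l}" for p
    by (auto simp: swap_subset_iff)
  then have "card {l \<in> (`) swap ` L. p \<subseteq> l} = card {l \<in> L. swap ` p \<subseteq> l}" for p
    by (simp add: card_image inj_image_swap)
  then show ?thesis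
    by (auto simp: multiple_points_def mem_image_image_swap)
qed

lemma rich_lines_swap: "rich_lines j ((`) swap ` P) = (`) swap ` rich_lines j P"
proof -
  have "{p \<in> (`) swap ` P. p \<subseteq> l} = (`) swap ` {p \<in> P. p \<subseteq> swap ` l}" for l
    by (auto simp: swap_subset_iff)
  then have "card {p \<in> (`) swap ` P. p \<subseteq> l} = card {p \<in> P. p \<subseteq> swap ` l}" for l
    by (simp add: card_image inj_image_swap)
  then show ?thesis
    by (auto simp: rich_lines_def mem_image_image_swap)
qed

lemma line_operator_swap: "line_operator m k ((`) swap ` L) = (`) swap ` line_operator m k L"
  by (simp add: line_operator_def multiple_points_swap rich_lines_swap)

text \<open>
  Since the operator commutes with projectivities, a single application that agrees with an
  involution already gives period two. This halves the combinatorial verification.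
\<close>
lemma line_operator_flips:
  assumes "line_operator m k A = (`) swap ` A"
  shows "line_operator m k (line_operator m k A) = A"
  using assms by (simp add: line_operator_swap image_image)

section \<open>Exact arithmetic in quadratic orders\<close>

text \<open>
  The pair \<open>(a, b)\<close> stands for \<open>a + b * \<theta>\<close>, where \<open>\<theta>\<close> is a nonreal root of
  \<open>X\<^sup>2 + c X + 1\<close>. The cases used are \<open>c = 0\<close> (Gaussian integers) and \<open>c = 1\<close> (Eisenstein integers).
\<close>
type_synonym qint = "int \<times> int"
type_synonym qvec = "qint \<times> qint \<times> qint"

abbreviation qzero :: qvec where "qzero \<equiv> ((0,0),(0,0),(0,0))"

fun qmul :: "int \<Rightarrow> qint \<Rightarrow> qint \<Rightarrow> qint" where
  "qmul c (a, b) (a', b') = (a * a' - b * b', a * b' + b * a' - c * (b * b'))"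

fun qadd :: "qint \<Rightarrow> qint \<Rightarrow> qint" where
  "qadd (a, b) (a', b') = (a + a', b + b')"

fun qsub :: "qint \<Rightarrow> qint \<Rightarrow> qint" where
  "qsub (a, b) (a', b') = (a - a', b - b')"

fun qdot :: "int \<Rightarrow> qvec \<Rightarrow> qvec \<Rightarrow> qint" where
  "qdot c (x, y, z) (x', y', z') = qadd (qmul c x x') (qadd (qmul c y y') (qmul c z z'))"

fun qcross :: "int \<Rightarrow> qvec \<Rightarrow> qvec \<Rightarrow> qvec" where
  "qcross c (x, y, z) (x', y', z') =
     (qsub (qmul c y z') (qmul c z y'),
      qsub (qmul c z x') (qmul c x z'),
      qsub (qmul c x y') (qmul c y x'))"

definition incident :: "int \<Rightarrow> qvec \<Rightarrow> qvec \<Rightarrow> bool" where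
  "incident c n v \<longleftrightarrow> qdot c n v = (0, 0)"

fun qswap :: "qvec \<Rightarrow> qvec" where
  "qswap (x, y, z) = (y, x, z)"

fun pairs :: "'a list \<Rightarrow> ('a \<times> 'a) list" where
  "pairs [] = []"
| "pairs (x # xs) = map (Pair x) xs @ pairs xs"

definition richness :: "int \<Rightarrow> qvec \<Rightarrow> qvec list \<Rightarrow> nat" where
  "richness c n D = length (filter (incident c n) D)"

text \<open>
  Listing the pairs of lines that meet in a double point, rather than the points, makes each double
  point appear exactly once: it determines the two lines through it.
\<close>
definition double_pairs :: "int \<Rightarrow> qvec list \<Rightarrow> (qvec \<times> qvec) list" where
  "double_pairs c N =
     filter (\<lambda>(m, n). length (filter (\<lambda>l. incident c l (qcross c m n)) N) = 2) (pairs N)"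

definition double_vecs :: "int \<Rightarrow> qvec list \<Rightarrow> qvec list" where
  "double_vecs c N = map (\<lambda>(m, n). qcross c m n) (double_pairs c N)"

declare qmul.simps [simp del] qadd.simps [simp del] qsub.simps [simp del]

lemma pairs_PairD: "distinct xs \<Longrightarrow> (x, y) \<in> set (pairs xs) \<Longrightarrow> x \<in> set xs \<and> y \<in> set xs \<and> x \<noteq> y \<and> (y, x) \<notin> set (pairs xs)"
proof (induction xs)
  case (Cons a xs)
  have sub: "u \<in> set xs \<and> v \<in> set xs" if "(u, v) \<in> set (pairs xs)" for u v
    using that by (induction xs) auto
  show ?case using Cons sub by auto
qed simp

lemma pairs_complete: "x \<in> set xs \<Longrightarrow> y \<in> set xs \<Longrightarrow> x \<noteq> y \<Longrightarrow> (x, y) \<in> set (pairs xs) \<or> (y, x) \<in> set (pairs xs)"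
  by (induction xs) auto

lemma distinct_pairs: "distinct xs \<Longrightarrow> distinct (pairs xs)"
proof (induction xs)
  case (Cons a xs)
  have sub: "u \<in> set xs \<and> v \<in> set xs" if "(u, v) \<in> set (pairs xs)" for u v
    using that by (induction xs) auto
  show ?case using Cons sub by (auto simp: distinct_map inj_on_def)
qed simp

locale quadratic_order =
  fixes c :: int and \<theta> :: complex
  assumes theta: "\<theta>\<^sup>2 = - 1 - of_int c * \<theta>" and Im_theta: "Im \<theta> \<noteq> 0"
begin

definition val :: "qint \<Rightarrow> complex" where
  "val x = of_int (fst x) + of_int (snd x) * \<theta>"

definition vec_of :: "qvec \<Rightarrow> complex^3" where
  "vec_of v = vector [val (fst v), val (fst (snd v)), val (snd (snd v))]"

lemma val_mult: "val (qmul c x y) = val x * val y"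
proof -
  have "val x * val y = of_int (fst x * fst y) + of_int (fst x * snd y + snd x * fst y) * \<theta>
          + of_int (snd x * snd y) * \<theta>\<^sup>2"
    by (simp add: val_def algebra_simps power2_eq_square)
  then show ?thesis
    by (cases x; cases y) (simp add: qmul.simps theta val_def algebra_simps)
qed

lemma val_add: "val (qadd x y) = val x + val y"
  by (cases x; cases y) (simp add: qadd.simps val_def algebra_simps)

lemma val_diff: "val (qsub x y) = val x - val y"
  by (cases x; cases y) (simp add: qsub.simps val_def algebra_simps)

lemma val_eq_0_iff: "val x = 0 \<longleftrightarrow> x = (0, 0)"
proof
  assume "val x = 0"
  then have "Im (val x) = 0" "Re (val x) = 0" by simp_all
  then show "x = (0, 0)" using Im_theta by (cases x) (auto simp: val_def)
qed (simp add: val_def)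

lemma vec_of_cross: "vec_of (qcross c u v) = cross (vec_of u) (vec_of v)"
  by (cases u; cases v) (simp add: vec_of_def cross_def val_mult val_diff)

lemma incident_iff: "incident c n v \<longleftrightarrow> dot3 (vec_of n) (vec_of v) = 0"
proof -
  have "val (qdot c n v) = dot3 (vec_of n) (vec_of v)"
    by (cases n; cases v) (simp add: vec_of_def dot3_def val_mult val_add)
  then show ?thesis by (metis incident_def val_eq_0_iff)
qed

lemma vec_of_eq_0_iff: "vec_of v = 0 \<longleftrightarrow> v = qzero"
  by (cases v) (auto simp: vec_of_def vec_eq_iff forall_3 val_eq_0_iff)

lemma vec_of_swap: "vec_of (qswap v) = swap (vec_of v)"
  by (cases v) (simp add: vec_of_def swap_def)

end

section \<open>The operator on an explicit list of lines\<close>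

locale line_list = quadratic_order +
  fixes N :: "qvec list"
  assumes distinct: "distinct N"
    and nonzero: "list_all (\<lambda>n. n \<noteq> qzero) N"
    and nonparallel: "list_all (\<lambda>(m, n). qcross c m n \<noteq> qzero) (pairs N)"
begin

definition lines :: "(complex^3) set set" where
  "lines = (\<lambda>n. line_of (vec_of n)) ` set N"

definition crossings :: "(qvec \<times> qvec) set" where
  "crossings = set (double_pairs c N)"

definition crossing :: "qvec \<times> qvec \<Rightarrow> complex^3" where
  "crossing = (\<lambda>(m, n). cross (vec_of m) (vec_of n))"

lemma cross_nonzero:
  assumes "m \<in> set N" "n \<in> set N" "m \<noteq> n" shows "cross (vec_of m) (vec_of n) \<noteq> 0"
proof -
  have *: "cross (vec_of m) (vec_of n) \<noteq> 0" if "(m, n) \<in> set (pairs N)" for m n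
    using that nonparallel by (auto simp: list_all_iff vec_of_eq_0_iff simp flip: vec_of_cross)
  from pairs_complete[OF assms] show ?thesis
    using *[of m n] *[of n m] by (auto simp: cross_swap_eq_0[of "vec_of m"])
qed

lemma vec_of_nonzero: "n \<in> set N \<Longrightarrow> vec_of n \<noteq> 0"
  using nonzero by (auto simp: list_all_iff vec_of_eq_0_iff)

lemma inj_line: "inj_on (\<lambda>n. line_of (vec_of n)) (set N)"
proof (rule inj_onI)
  fix m n assume mn: "m \<in> set N" "n \<in> set N" and "line_of (vec_of m) = line_of (vec_of n)"
  then have "cross (vec_of m) (vec_of n) = 0" by (simp add: line_of_eq_iff vec_of_nonzero)
  then show "m = n" using cross_nonzero mn by blast
qed

lemma finite_lines: "finite lines" and lines_in_cp2: "lines \<subseteq> cp2_lines"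
  by (auto simp: lines_def cp2_lines_eq vec_of_nonzero)

lemma multiplicity: "card {l \<in> lines. point_of v \<subseteq> l} = card {n \<in> set N. dot3 (vec_of n) v = 0}"
proof -
  have "{l \<in> lines. point_of v \<subseteq> l} = (\<lambda>n. line_of (vec_of n)) ` {n \<in> set N. dot3 (vec_of n) v = 0}"
    unfolding lines_def using point_of_subset_line_of by blast
  then show ?thesis
    by (simp add: card_image inj_on_subset[OF inj_line])
qed

lemma crossings_iff:
  "(m, n) \<in> crossings \<longleftrightarrow> (m, n) \<in> set (pairs N) \<and> {l \<in> set N. dot3 (vec_of l) (crossing (m, n)) = 0} = {m, n}"
proof -
  have "length (filter (\<lambda>l. incident c l (qcross c m n)) N) = 2 \<longleftrightarrow>
        {l \<in> set N. dot3 (vec_of l) (crossing (m, n)) = 0} = {m, n}" if mn: "(m, n) \<in> set (pairs N)"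
  proof -
    let ?S = "{l \<in> set N. dot3 (vec_of l) (crossing (m, n)) = 0}"
    have "length (filter (\<lambda>l. incident c l (qcross c m n)) N) = card ?S"
      using distinct by (simp add: incident_iff vec_of_cross crossing_def distinct_length_filter Int_def conj_commute)
    moreover have sub: "{m, n} \<subseteq> ?S" "m \<noteq> n"
      using pairs_PairD[OF distinct mn] by (auto simp: crossing_def dot3_commute[of _ "cross _ _"])
    have "card ?S = 2 \<longleftrightarrow> ?S = {m, n}"
      using card_subset_eq[OF _ sub(1)] sub(2) by auto
    ultimately show ?thesis by simp
  qed
  then show ?thesis by (auto simp: crossings_def double_pairs_def)
qed

lemma crossing_nonzero: "d \<in> crossings \<Longrightarrow> crossing d \<noteq> 0"
  using pairs_PairD[OF distinct] by (cases d) (auto simp: crossings_iff crossing_def cross_nonzero)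

lemma inj_point: "inj_on (\<lambda>d. point_of (crossing d)) crossings"
proof (rule inj_onI)
  fix d e assume d: "d \<in> crossings" and e: "e \<in> crossings" and eq: "point_of (crossing d) = point_of (crossing e)"
  obtain m n m' n' where [simp]: "d = (m, n)" "e = (m', n')" by (cases d; cases e)
  have "dot3 (vec_of l) (crossing d) = 0 \<longleftrightarrow> dot3 (vec_of l) (crossing e) = 0" for l
    using eq by (metis point_of_subset_line_of)
  then have "{m, n} = {m', n'}" using d e by (auto simp: crossings_iff)
  moreover have "(n, m) \<notin> crossings" using d pairs_PairD[OF distinct] by (auto simp: crossings_iff)
  ultimately show "d = e" using e by (auto simp: doubleton_eq_iff)
qed

lemma double_points: "multiple_points 2 lines = (\<lambda>d. point_of (crossing d)) ` crossings"
proof (intro equalityI subsetI)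
  fix p assume "p \<in> multiple_points 2 lines"
  then obtain v where v: "p = point_of v" "v \<noteq> 0" "card {n \<in> set N. dot3 (vec_of n) v = 0} = 2"
    by (auto simp: multiple_points_def cp2_points_eq multiplicity)
  then obtain m n where mn: "{l \<in> set N. dot3 (vec_of l) v = 0} = {m, n}" "m \<noteq> n"
    unfolding card_2_iff by blast
  have "m \<in> set N" "n \<in> set N" using mn(1) by blast+
  from pairs_complete[OF this mn(2)]
  have "\<exists>m n. {l \<in> set N. dot3 (vec_of l) v = 0} = {m, n} \<and> (m, n) \<in> set (pairs N)"
  proof
    assume "(n, m) \<in> set (pairs N)"
    moreover have "{l \<in> set N. dot3 (vec_of l) v = 0} = {n, m}"
      unfolding mn(1) by (rule insert_commute)
    ultimately show ?thesis by blast
  qed (use mn(1) in blast)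
  then obtain m n where mn: "{l \<in> set N. dot3 (vec_of l) v = 0} = {m, n}" "(m, n) \<in> set (pairs N)"
    by blast
  have "dot3 (vec_of m) v = 0" "dot3 (vec_of n) v = 0" using mn(1) by auto
  then have "cross v (crossing (m, n)) = 0" by (simp add: crossing_def cross_cross dot3_commute)
  moreover have "crossing (m, n) \<noteq> 0"
    using pairs_PairD[OF distinct mn(2)] by (simp add: crossing_def cross_nonzero)
  ultimately have eq: "point_of v = point_of (crossing (m, n))"
    using v(2) by (simp add: point_of_eq_iff)
  then have "dot3 (vec_of l) (crossing (m, n)) = 0 \<longleftrightarrow> dot3 (vec_of l) v = 0" for l
    by (metis point_of_subset_line_of)
  then have "(m, n) \<in> crossings" using mn by (simp add: crossings_iff)
  then show "p \<in> (\<lambda>d. point_of (crossing d)) ` crossings" using eq v(1) by blast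
next
  fix p assume "p \<in> (\<lambda>d. point_of (crossing d)) ` crossings"
  then obtain m n where mn: "(m, n) \<in> crossings" "p = point_of (crossing (m, n))" by auto
  then have "m \<noteq> n" using pairs_PairD[OF distinct] by (auto simp: crossings_iff)
  with mn show "p \<in> multiple_points 2 lines"
    using crossing_nonzero[OF mn(1)] by (auto simp: multiple_points_def cp2_points_eq multiplicity crossings_iff)
qed

lemma double_vecs_pairwise: "sorted_wrt (\<lambda>u v. cross (vec_of u) (vec_of v) \<noteq> 0) (double_vecs c N)"
proof -
  have "cross (crossing d) (crossing e) \<noteq> 0" if "d \<in> crossings" "e \<in> crossings" "d \<noteq> e" for d e
    using that inj_onD[OF inj_point, of d e] crossing_nonzero point_of_eq_iff[of "crossing d" "crossing e"] by blast
  moreover have "distinct (double_pairs c N)"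
    using distinct_pairs[OF distinct] by (simp add: double_pairs_def)
  ultimately have "sorted_wrt (\<lambda>d e. cross (crossing d) (crossing e) \<noteq> 0) (double_pairs c N)"
    by (simp add: sorted_wrt_iff_nth_less crossings_def nth_eq_iff_index_eq)
  then show ?thesis
    by (simp add: double_vecs_def sorted_wrt_map vec_of_cross crossing_def case_prod_beta)
qed

lemma richness_line: "card {p \<in> multiple_points 2 lines. p \<subseteq> line_of n} = card {d \<in> crossings. dot3 n (crossing d) = 0}"
proof -
  have "{p \<in> multiple_points 2 lines. p \<subseteq> line_of n} = (\<lambda>d. point_of (crossing d)) ` {d \<in> crossings. dot3 n (crossing d) = 0}"
    unfolding double_points using point_of_subset_line_of by blast
  then show ?thesis
    by (simp add: card_image inj_on_subset[OF inj_point])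
qed

lemma richness_list:
  "card {d \<in> crossings. P (crossing d)} = length (filter (\<lambda>v. P (vec_of v)) (double_vecs c N))"
proof -
  have "length (filter (\<lambda>v. P (vec_of v)) (double_vecs c N)) =
        length (filter (\<lambda>d. P (crossing d)) (double_pairs c N))"
    by (simp add: double_vecs_def filter_map comp_def crossing_def case_prod_beta vec_of_cross)
  also have "\<dots> = card {d \<in> crossings. P (crossing d)}"
  proof -
    have "distinct (double_pairs c N)"
      using distinct_pairs[OF distinct] by (simp add: double_pairs_def)
    moreover have "{d. P (crossing d)} \<inter> set (double_pairs c N) = {d \<in> crossings. P (crossing d)}"
      by (auto simp: crossings_def)
    ultimately show ?thesis by (simp add: distinct_length_filter)
  qed
  finally show ?thesis by simp
qed

lemma richness_eq: "card {d \<in> crossings. dot3 (vec_of n) (crossing d) = 0} = richness c n (double_vecs c N)"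
proof -
  have "incident c n = (\<lambda>v. dot3 (vec_of n) (vec_of v) = 0)"
    by (rule ext) (rule incident_iff)
  then show ?thesis
    using richness_list[of "\<lambda>v. dot3 (vec_of n) v = 0"] by (simp add: richness_def)
qed

text \<open>
  The list \<open>bs\<close> of candidates may contain lines that do not have exactly \<open>k\<close> double points. Such
  lines are needed because more than \<open>k\<close> double points may be collinear, and the test below for
  completeness only recognizes that at least \<open>k\<close> points are collinear.
\<close>
lemma line_operator_eq:
  assumes nz: "\<And>b. b \<in> set bs \<Longrightarrow> vec_of b \<noteq> 0"
    and complete: "\<And>n. n \<noteq> 0 \<Longrightarrow> card {d \<in> crossings. dot3 n (crossing d) = 0} = k \<Longrightarrow>
                      \<exists>b \<in> set bs. cross n (vec_of b) = 0"
    and rich: "filter (\<lambda>b. richness c b (double_vecs c N) = k) bs = map qswap N"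
  shows "line_operator 2 k lines = (`) swap ` lines"
proof -
  have "line_operator 2 k lines = (\<lambda>b. line_of (vec_of b)) ` {b \<in> set bs. richness c b (double_vecs c N) = k}"
    (is "?L = ?R")
  proof
    show "?L \<subseteq> ?R"
    proof
      fix l assume "l \<in> ?L"
      then obtain n where n: "l = line_of n" "n \<noteq> 0" "card {p \<in> multiple_points 2 lines. p \<subseteq> line_of n} = k"
        by (auto simp: line_operator_def rich_lines_def cp2_lines_eq)
      then obtain b where b: "b \<in> set bs" "cross n (vec_of b) = 0"
        using complete[OF n(2)] n(3) unfolding richness_line by blast
      then have "l = line_of (vec_of b)" using n nz by (simp add: line_of_eq_iff)
      moreover have "richness c b (double_vecs c N) = k"
      proof -
        have "card {p \<in> multiple_points 2 lines. p \<subseteq> line_of (vec_of b)} = k"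
          using n \<open>l = line_of (vec_of b)\<close> by simp
        then show ?thesis by (simp add: richness_line richness_eq)
      qed
      ultimately show "l \<in> ?R" using b by blast
    qed
    show "?R \<subseteq> ?L"
      using nz by (auto simp: line_operator_def rich_lines_def cp2_lines_eq richness_line richness_eq)
  qed
  also have "\<dots> = (\<lambda>b. line_of (vec_of b)) ` set (map qswap N)"
    by (simp flip: rich)
  also have "\<dots> = (`) swap ` lines"
    by (simp add: lines_def image_image vec_of_swap swap_line_of)
  finally show ?thesis .
qed

lemma line_operator_neq:
  assumes "n \<in> set N" "richness c n (double_vecs c N) \<noteq> k" shows "line_operator 2 k lines \<noteq> lines"
proof -
  have "line_of (vec_of n) \<notin> line_operator 2 k lines"
    using assms(2) by (simp add: line_operator_def rich_lines_def richness_line richness_eq)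
  then show ?thesis using assms(1) by (auto simp: lines_def)
qed

end

section \<open>Certificates\<close>

text \<open>
  A line through \<open>k \<ge> 2\<close> points of a list is the join of the first two of them, and then \<open>k - 2\<close> of the
  points after the second one lie on it. It therefore suffices to count, on the join of each pair,
  only the later points. The conditional, instead of a disjunction, keeps the rewriting engine from
  searching the candidates for the many pairs whose join is not rich.
\<close>
fun rich_joins_from_listed :: "int \<Rightarrow> nat \<Rightarrow> qvec list \<Rightarrow> qvec \<Rightarrow> qvec list \<Rightarrow> bool" where
  "rich_joins_from_listed c k bs d [] = True"
| "rich_joins_from_listed c k bs d (e # es) =
     ((if Suc (Suc (richness c (qcross c d e) es)) < k then True
       else list_ex (\<lambda>b. incident c b d \<and> incident c b e) bs) \<and> rich_joins_from_listed c k bs d es)"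

fun rich_joins_listed :: "int \<Rightarrow> nat \<Rightarrow> qvec list \<Rightarrow> qvec list \<Rightarrow> bool" where
  "rich_joins_listed c k bs [] = True"
| "rich_joins_listed c k bs (d # ds) = (rich_joins_from_listed c k bs d ds \<and> rich_joins_listed c k bs ds)"

lemma rich_joins_from_listed_append: "rich_joins_from_listed c k bs d (us @ es) \<Longrightarrow> rich_joins_from_listed c k bs d es"
  by (induction us) auto

lemma rich_joins_listed_append: "rich_joins_listed c k bs (us @ ds) \<Longrightarrow> rich_joins_listed c k bs ds"
  by (induction us) auto

context line_list
begin

lemma complete_if_rich_joins_listed:
  assumes n0: "n \<noteq> 0" and ok: "rich_joins_listed c k bs (double_vecs c N)" and k: "k \<ge> 2"
    and n: "card {d \<in> crossings. dot3 n (crossing d) = 0} = k"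
  shows "\<exists>b \<in> set bs. cross n (vec_of b) = 0"
proof -
  let ?P = "\<lambda>v. dot3 n (vec_of v) = 0"
  have len: "length (filter ?P (double_vecs c N)) = k"
    using n richness_list[of "\<lambda>v. dot3 n v = 0"] by simp
  then obtain d ds where d: "filter ?P (double_vecs c N) = d # ds" "length ds = k - 1"
    using k by (cases "filter ?P (double_vecs c N)") auto
  then obtain e es where e: "ds = e # es" "length es = k - 2"
    using k by (cases ds) auto
  obtain us vs where us: "double_vecs c N = us @ d # vs" "?P d" "filter ?P vs = e # es"
    using filter_eq_ConsD[OF d(1)] e(1) by metis
  obtain us' ws where ws: "vs = us' @ e # ws" "?P e" "filter ?P ws = es"
    using filter_eq_ConsD[OF us(3)] by metis
  have "rich_joins_from_listed c k bs d (e # ws)"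
    using ok us(1) ws(1) rich_joins_listed_append rich_joins_from_listed_append by (metis rich_joins_listed.simps(2))
  then have good: "if Suc (Suc (richness c (qcross c d e) ws)) < k then True
      else \<exists>b \<in> set bs. incident c b d \<and> incident c b e"
    by (auto simp: list_ex_iff split: if_splits)
  have ne: "cross (vec_of d) (vec_of e) \<noteq> 0"
  proof -
    have "sorted_wrt (\<lambda>u v. cross (vec_of u) (vec_of v) \<noteq> 0) (double_vecs c N)"
      by (rule double_vecs_pairwise)
    then show ?thesis unfolding us(1) ws(1) by (simp add: sorted_wrt_append)
  qed
  have nn: "cross n (cross (vec_of d) (vec_of e)) = 0"
    using us(2) ws(2) by (simp add: cross_cross)
  have "?P v \<Longrightarrow> incident c (qcross c d e) v" for v
    using dot3_eq_0_transfer[OF nn n0] by (simp add: incident_iff vec_of_cross)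
  then have "length es \<le> richness c (qcross c d e) ws"
    unfolding ws(3)[symmetric] richness_def by (induction ws) auto
  then have "\<not> Suc (Suc (richness c (qcross c d e) ws)) < k" using e(2) by simp
  then obtain b where b: "b \<in> set bs" "incident c b d" "incident c b e" using good by auto
  have "cross (vec_of b) (cross (vec_of d) (vec_of e)) = 0"
    using b by (simp add: cross_cross incident_iff)
  then have "cross n (vec_of b) = 0"
    using cross_trans nn ne cross_swap_eq_0 by blast
  then show ?thesis using b by blast
qed

end

definition certificate :: "int \<Rightarrow> nat \<Rightarrow> qvec list \<Rightarrow> qvec list \<Rightarrow> bool" where
  "certificate c k N E \<longleftrightarrow>
     distinct N \<and> list_all (\<lambda>n. n \<noteq> qzero) (N @ E) \<and>
     list_all (\<lambda>(m, n). qcross c m n \<noteq> qzero) (pairs N) \<and>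
     (let D = double_vecs c N; bs = map qswap N @ E in
        filter (\<lambda>b. richness c b D = k) bs = map qswap N \<and>
        rich_joins_listed c k bs D \<and>
        list_ex (\<lambda>n. richness c n D \<noteq> k) N)"

lemma (in quadratic_order) certificate_sound:
  assumes cert: "certificate c k N E" and k: "k \<ge> 2"
  shows "\<exists>A. line_arrangement A \<and> line_operator 2 k A \<noteq> A \<and>
             line_operator 2 k (line_operator 2 k A) = A"
proof -
  let ?bs = "map qswap N @ E"
  have N: "distinct N" "list_all (\<lambda>n. n \<noteq> qzero) N"
      "list_all (\<lambda>(m, n). qcross c m n \<noteq> qzero) (pairs N)"
    and E: "list_all (\<lambda>n. n \<noteq> qzero) E"
    and rich: "filter (\<lambda>b. richness c b (double_vecs c N) = k) ?bs = map qswap N"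
    and joins: "rich_joins_listed c k ?bs (double_vecs c N)"
    and ex: "list_ex (\<lambda>n. richness c n (double_vecs c N) \<noteq> k) N"
    using cert unfolding certificate_def Let_def list_all_append by blast+
  interpret line_list c \<theta> N
    by unfold_locales (fact N)+
  have "vec_of b \<noteq> 0" if "b \<in> set ?bs" for b
    using that unfolding set_append set_map
  proof (elim UnE imageE)
    fix n assume "n \<in> set N" "b = qswap n"
    then show ?thesis by (simp only: vec_of_swap swap_eq_0_iff vec_of_nonzero not_False_eq_True)
  next
    assume "b \<in> set E"
    then show ?thesis using E unfolding list_all_iff vec_of_eq_0_iff by blast
  qed
  then have "line_operator 2 k lines = (`) swap ` lines"
    using complete_if_rich_joins_listed[OF _ joins k] rich by (rule line_operator_eq)
  then have "line_operator 2 k (line_operator 2 k lines) = lines"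
    by (rule line_operator_flips)
  moreover obtain n where "n \<in> set N" "richness c n (double_vecs c N) \<noteq> k"
    using ex unfolding list_ex_iff by blast
  then have "line_operator 2 k lines \<noteq> lines"
    by (rule line_operator_neq)
  moreover have "line_arrangement lines"
    by (simp add: line_arrangement_def finite_lines lines_in_cp2)
  ultimately show ?thesis by blast
qed

section \<open>The four arrangements\<close>

text \<open>The lines \<open>y = a z\<close>, \<open>z = a x\<close>, \<open>x = a y\<close> through the vertices of the coordinate triangle.\<close>

definition vertex_lines :: "qint list \<Rightarrow> qvec list" where
  "vertex_lines as =
     concat (map (\<lambda>(a, b). [((0,0), (1,0), (-a,-b)),
                            ((-a,-b), (0,0), (1,0)),
                            ((1,0), (-a,-b), (0,0))]) as)"

text \<open>
  The additional candidates are the lines of the arrangement with \<open>a^m = \<tau>\<close>: each contains \<open>4 m\<close> double points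
  off the triangle, which is more than \<open>k\<close>.
\<close>

lemma certificate_3: "certificate 0 3 (vertex_lines [(1,0), (2,0)]) (vertex_lines [(2,0)])"
  by code_simp

lemma certificate_4:
  "certificate 0 4 (vertex_lines [(1,0), (-1,0), (2,0), (-2,0)]) (vertex_lines [(2,0), (-2,0)])"
  by code_simp

text \<open>
  These normals are the points of order dividing 4 on an elliptic curve, except for the origin
  \<open>(1 : -1 : 0)\<close> and three points of order 4 with sum zero. The first two entries are opposite points,
  the third, fourth and eighth are the points of order 2.
\<close>

lemma certificate_5:
  "certificate 0 5
     [((1,0), (0,0), (0,0)), ((0,0), (1,0), (0,0)),
      ((0,0), (0,0), (1,0)), ((1,0), (1,0), (1,0)),
      ((0,0), (1,0), (1,0)), ((1,0), (0,1), (-1,0)),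
      ((1,0), (0,-1), (0,1)), ((1,2), (1,2), (-1,0)),
      ((1,0), (-1,-2), (-1,0)), ((1,2), (2,-1), (1,0)),
      ((1,2), (1,0), (0,1)), ((1,2), (-1,0), (1,0))]
     []"
  by code_simp

lemma certificate_6:
  "certificate 1 6 (vertex_lines [(1,0), (0,1), (-1,-1), (2,0), (0,2), (-2,-2)])
     (vertex_lines [(2,0), (0,2), (-2,-2)])"
  by code_simp

theorem mainTheorem1:
  fixes k :: nat
  assumes "k \<in> {3, 4, 5, 6}"
  shows "\<exists>A. line_arrangement A \<and>
             line_operator 2 k A \<noteq> A \<and>
             line_operator 2 k (line_operator 2 k A) = A"
proof -
  interpret gauss: quadratic_order 0 \<i>
    by unfold_locales simp_all
  interpret eisenstein: quadratic_order 1 "Complex (- 1 / 2) (sqrt 3 / 2)"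
    by unfold_locales (simp_all add: complex_eq_iff power2_eq_square)
  from assms consider "k = 3" | "k = 4" | "k = 5" | "k = 6" by auto
  then show ?thesis
  proof cases
    case 1
    then show ?thesis using gauss.certificate_sound[OF certificate_3] by simp
  next
    case 2
    then show ?thesis using gauss.certificate_sound[OF certificate_4] by simp
  next
    case 3
    then show ?thesis using gauss.certificate_sound[OF certificate_5] by simp
  next
    case 4
    then show ?thesis using eisenstein.certificate_sound[OF certificate_6] by simp
  qed
qed

end
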